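(* Let $q(z)=\mathcal{N}(z\mid\mu,\Sigma)$ be a multivariate Gaussian distribution with mean $\mu\in\mathbb{R}^d$ and symmetric positive definite covariance matrix $\Sigma\in\mathbb{R}^{d\times d}$. Let $h:\mathbb{R}^d\to\mathbb{R}$ be continuously differentiable with $\nabla_zh$ locally ACL, and suppose $\mathbb{E}_q[h(z)]$ is well-defined. Assume moreover that $\mathbb{E}_q[\Sigma^{-1}(z-\mu)\nabla_z^Th(z)]$, $\mathbb{E}_q[\nabla_z^2h(z)]$ and $\mathbb{E}_q\big[h(z)\frac{\nabla_\Sigma q(z)}{q(z)}\big]$ are well-defined, and that differentiation and integration may be interchanged, i.e. $\nabla_\Sigma\mathbb{E}_q[h(z)]=\mathbb{E}_q\big[h(z)\frac{\nabla_\Sigma q(z)}{q(z)}\big]$. Then $$\nabla_\Sigma\mathbb{E}_q[h(z)]=\tfrac12\,\mathbb{E}_q\big[\Sigma^{-1}(z-\mu)\nabla_z^Th(z)\big]=\tfrac12\,\mathbb{E}_q\big[\nabla_z^2h(z)\big].$$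
   Context: An expectation $\mathbb{E}_q[g]$ is called well-defined if $\mathbb{E}_q[\|g\|]<\infty$ (Euclidean norm; Frobenius norm for matrices). A function $g:[a,b]\to\mathbb{R}^m$ is absolutely continuous (AC) if its derivative exists almost everywhere on $[a,b]$, is Lebesgue integrable, and $g(x)=g(a)+\int_a^x g'(t)\,dt$ for all $x\in[a,b]$. A function $g:\mathbb{R}\to\mathbb{R}^m$ is locally AC if it is AC on every compact interval. A function $g:\mathbb{R}^d\to\mathbb{R}^m$ is locally ACL if for every $i$ and almost every $z_{-i}\in\mathbb{R}^{d-1}$ (all coordinates except the $i$-th), the function $z_i\mapsto g(z_i,z_{-i})$ is locally AC; its partial derivatives then exist almost everywhere. $\nabla_zh$ is the gradient as a column vector, $\nabla_z^Th$ its transpose, and $\nabla_z^2h$ the matrix of second partial derivatives (existing almost everywhere). $\nabla_\Sigma F$ denotes the symmetric matrix $G$ such that the derivative of $F$ at $\Sigma$ in each symmetric direction $H$ is $\mathrm{tr}(GH)$; with this convention $\nabla_\Sigma\mathcal{N}(z\mid\mu,\Sigma)=\frac12\Sigma^{-1}[(z-\mu)(z-\mu)^T-\Sigma]\Sigma^{-1}\mathcal{N}(z\mid\mu,\Sigma)$. *)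

theory Defs
  imports "HOL-Analysis.Analysis"
begin

section \<open>Multivariate Gaussian distributions\<close>

definition sym_pos_def :: "real^'n^'n \<Rightarrow> bool" where
  "sym_pos_def S \<longleftrightarrow> transpose S = S \<and> (\<forall>x. x \<noteq> 0 \<longrightarrow> 0 < x \<bullet> (S *v x))"

definition gauss_density :: "real^'n \<Rightarrow> real^'n^'n \<Rightarrow> real^'n \<Rightarrow> real" where
  "gauss_density \<mu> S z =
     exp (- ((z - \<mu>) \<bullet> (matrix_inv S *v (z - \<mu>))) / 2) / sqrt ((2 * pi) ^ CARD('n) * det S)"

definition gauss :: "real^'n \<Rightarrow> real^'n^'n \<Rightarrow> (real^'n) measure" where
  "gauss \<mu> S = density lborel (\<lambda>z. ennreal (gauss_density \<mu> S z))"

text \<open>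
  Expectations are Bochner integrals over \<^term>\<open>gauss \<mu> S\<close>, and an expectation is well-defined
  iff the function is \<^const>\<open>integrable\<close>. The norm of \<^typ>\<open>real^'n^'n\<close> is the Frobenius norm.
\<close>

section \<open>Absolute continuity\<close>

definition AC_on :: "real \<Rightarrow> real \<Rightarrow> (real \<Rightarrow> 'b::euclidean_space) \<Rightarrow> bool" where
  "AC_on a b g \<longleftrightarrow>
     (AE t in lebesgue. t \<in> {a..b} \<longrightarrow> g differentiable (at t within {a..b})) \<and>
     set_integrable lebesgue {a..b} (\<lambda>t. vector_derivative g (at t within {a..b})) \<and>
     (\<forall>x\<in>{a..b}. g x = g a + (LINT t:{a..x}|lebesgue. vector_derivative g (at t within {a..b})))"

definition locally_AC :: "(real \<Rightarrow> 'b::euclidean_space) \<Rightarrow> bool" where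
  "locally_AC g \<longleftrightarrow> (\<forall>a b. a \<le> b \<longrightarrow> AC_on a b g)"

text \<open>
  The remaining coordinates \<open>z\<^sub>-\<^sub>i\<close> are a point \<open>w\<close> of the product space over the index set
  \<open>UNIV - {i}\<close>, carrying the product Lebesgue measure (a one-point space of mass 1 when the
  dimension is 1).
\<close>

definition locally_ACL :: "(real^'n \<Rightarrow> 'b::euclidean_space) \<Rightarrow> bool" where
  "locally_ACL g \<longleftrightarrow>
     (\<forall>i. AE w in (\<Pi>\<^sub>M j\<in>UNIV - {i}. (lborel :: real measure)).
        locally_AC (\<lambda>t. g (\<chi> j. if j = i then t else w j)))"

section \<open>Derivatives\<close>

definition grad :: "(real^'n \<Rightarrow> real) \<Rightarrow> real^'n \<Rightarrow> real^'n" where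
  "grad h z = (THE D. GDERIV h z :> D)"

definition continuously_differentiable :: "(real^'n \<Rightarrow> real) \<Rightarrow> bool" where
  "continuously_differentiable h \<longleftrightarrow>
     (\<forall>z. h differentiable (at z)) \<and> continuous_on UNIV (grad h)"

definition partial_deriv :: "'n \<Rightarrow> (real^'n \<Rightarrow> real) \<Rightarrow> real^'n \<Rightarrow> real" where
  "partial_deriv i f z = deriv (\<lambda>t. f (z + t *\<^sub>R axis i 1)) 0"

text \<open>
  The \<open>(i, j)\<close> entry is the \<open>i\<close>-th partial derivative of the \<open>j\<close>-th component of the gradient.
  It carries its intended meaning only at points where this partial derivative exists, which is
  almost everywhere if the gradient is locally ACL.
\<close>

definition hessian :: "(real^'n \<Rightarrow> real) \<Rightarrow> real^'n \<Rightarrow> real^'n^'n" where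
  "hessian h z = (\<chi> i j. partial_deriv i (\<lambda>y. grad h y $ j) z)"

text \<open>Gradient of a function of a symmetric matrix, with respect to the trace pairing.\<close>

definition has_sym_grad :: "(real^'n^'n \<Rightarrow> real) \<Rightarrow> real^'n^'n \<Rightarrow> real^'n^'n \<Rightarrow> bool" where
  "has_sym_grad F G S \<longleftrightarrow> transpose G = G \<and>
     (\<forall>H. transpose H = H \<longrightarrow>
        ((\<lambda>t. F (S + t *\<^sub>R H)) has_real_derivative trace (G ** H)) (at 0))"

definition sym_grad :: "(real^'n^'n \<Rightarrow> real) \<Rightarrow> real^'n^'n \<Rightarrow> real^'n^'n" where
  "sym_grad F S = (THE G. has_sym_grad F G S)"

definition outer :: "real^'n \<Rightarrow> real^'n \<Rightarrow> real^'n^'n" where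
  "outer u v = (\<chi> i j. u $ i * v $ j)"

end

(*
  Write q for the density, x = S^-1 (z - mu) and P = S^-1, so that the partial derivatives of q
  are - x_i q. Differentiating the determinant and the inverse of the covariance gives the
  gradient (q/2) (x x^T - P) of q with respect to S. Both equalities are then instances of the
  integration by parts E[partial_i f] = E[x_i f]: for f = x_i h in direction j, and for the j-th
  component f of the gradient of h in direction i. To prove the latter, restrict f q to almost
  every line in direction i: there it is absolutely continuous, and it is integrable together with
  its derivative, so that it tends to 0 at both ends and its derivative has integral 0.
  That f q is integrable is not among the hypotheses: the bound |x_i h| <= |h| + |x_i^2 h| gives it
  in the first case; in the second, |x_k f| dominates |f| up to a constant outside the compact set
  |x| <= 1, on which f is bounded by continuity.
*)
theory Submission
  imports Defs
begin

section \<open>Integration by parts on the real line\<close>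

text \<open>A nonzero limit would keep \<open>\<bar>F x\<bar>\<close> above half its modulus on a
  whole ray, and integrability of \<open>F\<close> would then give that ray finite measure.\<close>

lemma integrable_tendsto_at_top_eq_0:
  fixes F :: "real \<Rightarrow> real"
  assumes F: "integrable lborel F" and L: "(F \<longlongrightarrow> L) at_top"
  shows "L = 0"
proof (rule ccontr)
  assume "L \<noteq> 0"
  then have "\<forall>\<^sub>F x in at_top. \<bar>F x\<bar> > \<bar>L\<bar> / 2"
    using tendsto_rabs[OF L] by (intro order_tendstoD) auto
  then obtain N where N: "\<And>x. x \<ge> N \<Longrightarrow> \<bar>F x\<bar> > \<bar>L\<bar> / 2"
    by (auto simp: eventually_at_top_linorder)
  have "integrable lborel (\<lambda>x. indicator {N..} x * (\<bar>L\<bar> / 2))"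
    by (rule Bochner_Integration.integrable_bound[OF F])
       (use N in \<open>force simp: indicator_def\<close>)+
  from integrable_mult_left[OF this, of "2 / \<bar>L\<bar>"]
  have "integrable lborel (indicator {N..} :: real \<Rightarrow> real)"
    using \<open>L \<noteq> 0\<close> by simp
  then have fin: "emeasure lborel {N..} < \<infinity>"
    by (simp add: integrable_indicator_iff)
  \<comment> \<open>A bounded interval inside the ray that is longer by 1 than the supposed measure
    of the ray.\<close>
  have "emeasure lborel {N..N + (measure lborel {N..} + 1)} \<le> emeasure lborel {N..}"
    by (rule emeasure_mono) auto
  also have "\<dots> = ennreal (measure lborel {N..})"
    using fin by (intro emeasure_eq_ennreal_measure) auto
  finally show False
    by (simp add: ennreal_le_iff2)
qed

text \<open>As \<open>y\<close> grows, \<open>F y\<close> is \<open>F 0\<close> plus the integral of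
  \<open>D\<close> up to \<open>y\<close>, which converges since \<open>D\<close> is integrable. So
  \<open>F\<close> has a limit, and the previous lemma forces it to be 0.\<close>

lemma integral_Ici_eq_uminus:
  fixes F D :: "real \<Rightarrow> real"
  assumes F: "integrable lborel F" and D: "integrable lborel D"
    and FTC: "\<And>y. 0 \<le> y \<Longrightarrow> F y - F 0 = (LBINT t:{0..y}. D t)"
  shows "(LBINT t:{0..}. D t) = - F 0"
proof -
  have D0: "integrable lborel (\<lambda>t. indicator {0..} t *\<^sub>R D t)"
    by (rule integrable_mult_indicator[OF _ D]) auto
  have "((\<lambda>y. F 0 + (LBINT t. indicator {..y} t *\<^sub>R (indicator {0..} t *\<^sub>R D t)))
           \<longlongrightarrow> F 0 + (LBINT t:{0..}. D t)) at_top"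
    unfolding set_lebesgue_integral_def
    by (intro tendsto_intros tendsto_integral_at_top[OF _ D0]) simp
  moreover have "\<forall>\<^sub>F y in at_top. F 0 + (LBINT t. indicator {..y} t *\<^sub>R (indicator {0..} t *\<^sub>R D t)) = F y"
    using eventually_ge_at_top[of 0]
  proof eventually_elim
    case (elim y)
    have "(LBINT t. indicator {..y} t *\<^sub>R (indicator {0..} t *\<^sub>R D t)) = (LBINT t:{0..y}. D t)"
      unfolding set_lebesgue_integral_def
      by (intro Bochner_Integration.integral_cong) (auto simp: indicator_def)
    then show ?case using FTC[OF elim] by simp
  qed
  ultimately have "(F \<longlongrightarrow> F 0 + (LBINT t:{0..}. D t)) at_top"
    by (rule Lim_transform_eventually)
  from integrable_tendsto_at_top_eq_0[OF F this] show ?thesis by simp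
qed

text \<open>The half-line lemma is applied to \<open>F\<close> and to its reflection
  \<open>F (- t)\<close>, whose derivative is \<open>- D (- t)\<close>. The two halves contribute
  \<open>- F 0\<close> and \<open>F 0\<close>, which cancel.\<close>

lemma integral_derivative_eq_0:
  fixes F D :: "real \<Rightarrow> real"
  assumes F: "integrable lborel F" and D: "integrable lborel D"
    and FTC: "\<And>a b. a \<le> b \<Longrightarrow> F b - F a = (LBINT t:{a..b}. D t)"
  shows "(LBINT t. D t) = 0"
proof -
  have 1: "(LBINT t:{0..}. D t) = - F 0"
    by (rule integral_Ici_eq_uminus[OF F D FTC])
  have "(LBINT t:{0..}. - D (- t)) = - F (- 0)"
  proof (rule integral_Ici_eq_uminus[where F = "\<lambda>t. F (- t)"])
    show "integrable lborel (\<lambda>t. F (- t))" "integrable lborel (\<lambda>t. - D (- t))"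
      using lborel_integrable_real_affine[OF F, of "-1" 0] lborel_integrable_real_affine[OF D, of "-1" 0]
      by simp_all
    fix y :: real assume "0 \<le> y"
    have "(LBINT t:{0..y}. D (- t)) = (LBINT t:{-y..0}. D t)"
      unfolding set_lebesgue_integral_def
      by (subst (2) lborel_integral_real_affine[of "-1" _ 0])
         (auto intro!: Bochner_Integration.integral_cong simp: indicator_def)
    then show "F (- y) - F (- 0) = (LBINT t:{0..y}. - D (- t))"
      using FTC[of "- y" 0] \<open>0 \<le> y\<close> by (simp add: set_lebesgue_integral_def)
  qed
  moreover have "(LBINT t:{0..}. D (- t)) = (LBINT t:{..0}. D t)"
    unfolding set_lebesgue_integral_def
    by (subst (2) lborel_integral_real_affine[of "-1" _ 0])
       (auto intro!: Bochner_Integration.integral_cong simp: indicator_def)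
  ultimately have 2: "(LBINT t:{..0}. D t) = F 0"
    by (simp add: set_lebesgue_integral_def)
  have int: "integrable lborel (\<lambda>t. indicator A t *\<^sub>R D t)" if "A \<in> sets borel" for A
    by (rule integrable_mult_indicator[OF _ D]) (use that in auto)
  have "(LBINT t. D t) = (LBINT t. indicator {0..} t *\<^sub>R D t + indicator {..0} t *\<^sub>R D t)"
  proof (rule integral_cong_AE)
    show "AE t in lborel. D t = indicator {0..} t *\<^sub>R D t + indicator {..0} t *\<^sub>R D t"
      using AE_lborel_singleton[of 0] by eventually_elim (auto simp: indicator_def)
  qed (use D in auto)
  also have "\<dots> = (LBINT t:{0..}. D t) + (LBINT t:{..0}. D t)"
    unfolding set_lebesgue_integral_def by (intro Bochner_Integration.integral_add int) auto
  finally show ?thesis using 1 2 by simp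
qed

text \<open>Here \<open>d\<close> is merely an integrable density of \<open>g\<close>, so the
  product rule is not applied pointwise. Instead the double integral of \<open>d s * p' t\<close>
  over a triangle is computed in both orders: integrating over \<open>t\<close> first leaves
  \<open>d s * (p b - p s)\<close>, integrating over \<open>s\<close> first leaves
  \<open>p' t * (g t - g a)\<close>. Equating the two is the claim.\<close>

lemma integral_by_parts_AC:
  fixes g d p p' :: "real \<Rightarrow> real"
  assumes "a \<le> b" and d: "set_integrable lborel {a..b} d"
    and g: "\<And>x. x \<in> {a..b} \<Longrightarrow> g x = g a + (LBINT t:{a..x}. d t)"
    and p: "\<And>x. (p has_real_derivative p' x) (at x)" and p': "continuous_on UNIV p'"
  shows "g b * p b - g a * p a = (LBINT t:{a..b}. d t * p t + g t * p' t)"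
proof -
  define d0 where "d0 t = indicator {a..b} t * d t" for t
  define e0 where "e0 t = indicator {a..b} t * p' t" for t
  have d0: "integrable lborel d0"
    using d by (simp add: set_integrable_def d0_def[abs_def])
  have e0: "integrable lborel e0"
    using borel_integrable_compact[of "{a..b}" p'] p'
    by (auto simp: e0_def[abs_def] intro: continuous_on_subset)
  note [measurable] = borel_measurable_integrable[OF d0] borel_measurable_integrable[OF e0]
  \<comment> \<open>Fubini over the triangle \<open>a \<le> s \<le> t \<le> b\<close> for the integrand \<open>d s * p' t\<close>.\<close>
  define k where "k = (\<lambda>(s, t). indicator {x. fst x \<le> snd x} (s, t) * (d0 s * e0 t))"
  have [measurable]: "k \<in> borel_measurable (lborel \<Otimes>\<^sub>M lborel)"
    unfolding k_def by measurable
  have k: "integrable (lborel \<Otimes>\<^sub>M lborel) k"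
  proof (rule Bochner_Integration.integrable_bound)
    show "integrable (lborel \<Otimes>\<^sub>M lborel) (\<lambda>(s, t). d0 s * e0 t)"
    proof (rule lborel_pair.Fubini_integrable)
      show "integrable lborel (\<lambda>s. LBINT t. norm (case (s, t) of (s, t) \<Rightarrow> d0 s * e0 t))"
        using d0 by (simp add: abs_mult)
      show "AE s in lborel. integrable lborel (\<lambda>t. case (s, t) of (s, t) \<Rightarrow> d0 s * e0 t)"
        using e0 by simp
    qed measurable
    show "AE x in lborel \<Otimes>\<^sub>M lborel. norm (k x) \<le> norm (case x of (s, t) \<Rightarrow> d0 s * e0 t)"
      by (auto simp: k_def indicator_def)
  qed measurable
  have FTC: "(LBINT t. indicator {s..b} t * p' t) = p b - p s" if "s \<le> b" for s
    using integral_FTC_atLeastAtMost[of s b p p'] that p p'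
    by (auto simp: has_real_derivative_iff_has_vector_derivative
        intro: has_vector_derivative_at_within continuous_on_subset)
  have inner1: "(LBINT t. k (s, t)) = d0 s * (p b - p s)" for s
  proof (cases "s \<in> {a..b}")
    case True
    have "(LBINT t. k (s, t)) = (LBINT t. d0 s * (indicator {s..b} t * p' t))"
      using True by (intro Bochner_Integration.integral_cong) (auto simp: k_def e0_def indicator_def)
    then show ?thesis using FTC[of s] True by simp
  qed (auto simp: k_def d0_def)
  have inner2: "(LBINT s. k (s, t)) = e0 t * (g t - g a)" for t
  proof (cases "t \<in> {a..b}")
    case True
    have "(LBINT s. k (s, t)) = (LBINT s. e0 t * (indicator {a..t} s * d s))"
      using True by (intro Bochner_Integration.integral_cong) (auto simp: k_def d0_def indicator_def)
    then show ?thesis using g[of t] True by (simp add: set_lebesgue_integral_def)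
  qed (auto simp: k_def e0_def)
  have swap: "(LBINT s. d0 s * (p b - p s)) = (LBINT t. e0 t * (g t - g a))"
    using lborel_pair.Fubini_integral[of "\<lambda>s t. k (s, t)"] k by (simp add: inner1 inner2)
  \<comment> \<open>Fubini also yields that both marginals are measurable and integrable. This is
    how \<open>e0 t * g t\<close> and \<open>d0 t * p t\<close> become integrable, although no
    measurability of \<open>g\<close> is assumed.\<close>
  have "integrable lborel (\<lambda>t. e0 t * (g t - g a))"
    using lborel_pair.integrable_snd[of "\<lambda>s t. k (s, t)"] k by (simp add: inner2)
  from Bochner_Integration.integrable_add[OF this integrable_mult_left[OF e0, of "g a"]]
  have gi: "integrable lborel (\<lambda>t. e0 t * g t)"
    by (simp add: algebra_simps)
  have "integrable lborel (\<lambda>s. d0 s * (p b - p s))"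
    using lborel_pair.integrable_fst[of "\<lambda>s t. k (s, t)"] k by (simp add: inner1)
  from Bochner_Integration.integrable_diff[OF integrable_mult_left[OF d0, of "p b"] this]
  have di: "integrable lborel (\<lambda>t. d0 t * p t)"
    by (simp add: algebra_simps)
  have "(LBINT t:{a..b}. d t * p t + g t * p' t) = (LBINT t. d0 t * p t + e0 t * g t)"
    unfolding set_lebesgue_integral_def
    by (intro Bochner_Integration.integral_cong) (auto simp: d0_def e0_def algebra_simps)
  also have "\<dots> = (LBINT t. d0 t * p t) + (LBINT t. e0 t * g t)"
    using di gi by simp
  also have "(LBINT t. d0 t * p t) = (LBINT t. d0 t) * p b - (LBINT t. d0 t * (p b - p t))"
    using d0 di by (simp add: right_diff_distrib)
  also have "(LBINT t. e0 t * g t) = (LBINT t. e0 t * (g t - g a)) + (LBINT t. e0 t) * g a"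
    using e0 gi by (simp add: right_diff_distrib)
  also have "(LBINT t. d0 t) = g b - g a"
    using g[of b] \<open>a \<le> b\<close> by (simp add: d0_def set_lebesgue_integral_def)
  also have "(LBINT t. e0 t) = p b - p a"
    using FTC[of a] \<open>a \<le> b\<close> by (simp add: e0_def)
  finally show "g b * p b - g a * p a = (LBINT t:{a..b}. d t * p t + g t * p' t)"
    using swap by (simp add: algebra_simps)
qed

section \<open>Integration along coordinate lines\<close>

lemma Basis_vec_real: "(Basis :: (real^'n) set) = range (\<lambda>i. axis i 1)"
  by (auto simp: Basis_vec_def)

lemma measurable_vec_lambda_PiM [measurable]:
  "(\<lambda>w. \<chi> j. w j) \<in> (\<Pi>\<^sub>M j\<in>UNIV. lborel) \<rightarrow>\<^sub>M (borel :: (real^'n) measure)"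
proof -
  have "(\<lambda>w. (\<chi> j. w j) \<bullet> b) \<in> borel_measurable (\<Pi>\<^sub>M j\<in>UNIV. lborel)"
    if "b \<in> (Basis :: (real^'n) set)" for b
    using that by (auto simp: Basis_vec_real inner_axis)
  then show ?thesis
    by (subst borel_measurable_euclidean_space) blast
qed

text \<open>Lebesgue measure is determined by its values on boxes, and the preimage of a box is a
  product of intervals. This carries Fubini's theorem for product measures over to
  \<open>real^'n\<close>.\<close>

lemma lborel_vec_eq_distr_PiM:
  "(lborel :: (real^'n) measure) = distr (\<Pi>\<^sub>M j\<in>UNIV. lborel) borel (\<lambda>w. \<chi> j. w j)"
proof (rule lborel_eqI)
  interpret finite_product_sigma_finite "\<lambda>_. lborel :: real measure" "UNIV :: 'n set"
    by standard auto
  fix l u :: "real^'n"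
  assume "\<And>b. b \<in> Basis \<Longrightarrow> l \<bullet> b \<le> u \<bullet> b"
  then have le: "l $ i \<le> u $ i" for i
    by (force simp: Basis_vec_real inner_axis)
  have "(\<lambda>w. \<chi> j. w j) -` box l u \<inter> space (\<Pi>\<^sub>M j\<in>UNIV. (lborel :: real measure))
      = (\<Pi>\<^sub>E j\<in>UNIV. {l $ j<..<u $ j})"
    by (auto simp: space_PiM mem_box_cart PiE_def Pi_iff)
  then have "emeasure (distr (\<Pi>\<^sub>M j\<in>UNIV. lborel) borel (\<lambda>w. \<chi> j. w j)) (box l u)
      = (\<Prod>j\<in>UNIV. emeasure lborel {l $ j<..<u $ j})"
    by (simp add: emeasure_distr measure_times)
  also have "\<dots> = ennreal (\<Prod>j\<in>UNIV. u $ j - l $ j)"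
    using le by (simp add: prod_ennreal)
  also have "(\<Prod>j\<in>UNIV. u $ j - l $ j) = (\<Prod>b\<in>Basis. (u - l) \<bullet> b)"
    unfolding Basis_vec_real
    by (subst prod.reindex) (auto simp: inj_on_def axis_eq_axis inner_axis)
  finally show "emeasure (distr (\<Pi>\<^sub>M j\<in>UNIV. lborel) borel (\<lambda>w. \<chi> j. w j)) (box l u)
      = ennreal (\<Prod>b\<in>Basis. (u - l) \<bullet> b)" .
qed simp

text \<open>The line used in \<open>locally_ACL\<close>. The value of \<open>w\<close> at
  \<open>i\<close> is overwritten, so \<open>w\<close> may be a point of the product space over
  \<open>UNIV - {i}\<close>.\<close>

definition coord_line :: "'n \<Rightarrow> ('n \<Rightarrow> real) \<Rightarrow> real \<Rightarrow> real^'n" where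
  "coord_line i w t = (\<chi> j. if j = i then t else w j)"

lemma continuous_on_coord_line: "continuous_on UNIV (coord_line i w)"
  unfolding coord_line_def
proof (rule continuous_on_vec_lambda)
  show "continuous_on UNIV (\<lambda>t. if j = i then t else w j)" for j
    by (cases "j = i") auto
qed

text \<open>Fubini's theorem with coordinate \<open>i\<close> split off and integrated innermost.
  For the first claim, Tonelli makes the iterated integral of the norm finite, so the inner integral
  is finite for almost every \<open>w\<close>.\<close>

lemma
  fixes f :: "real^'n \<Rightarrow> real"
  assumes f: "integrable lborel f"
  shows AE_integrable_coord_line:
      "AE w in (\<Pi>\<^sub>M j\<in>UNIV - {i}. lborel). integrable lborel (\<lambda>t. f (coord_line i w t))"
    and integral_eq_coord_line:
      "(LBINT z. f z) = (LINT w|(\<Pi>\<^sub>M j\<in>UNIV - {i}. lborel). (LBINT t. f (coord_line i w t)))"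
proof -
  interpret product_sigma_finite "\<lambda>_ :: 'n. lborel :: real measure"
    by standard
  have I: "insert i (UNIV - {i}) = UNIV" by auto
  let ?g = "\<lambda>w. f (\<chi> j. w j)"
  have [measurable]: "f \<in> borel_measurable borel"
    using f by auto
  have g: "integrable (\<Pi>\<^sub>M j\<in>UNIV. lborel) ?g"
    using f by (subst (asm) lborel_vec_eq_distr_PiM) (simp add: integrable_distr_eq)
  have "(LBINT z. f z) = (LINT w|(\<Pi>\<^sub>M j\<in>UNIV. lborel). ?g w)"
    by (subst lborel_vec_eq_distr_PiM) (simp add: integral_distr)
  also have "\<dots> = (LINT w|(\<Pi>\<^sub>M j\<in>UNIV - {i}. lborel). (LBINT t. f (coord_line i w t)))"
    using product_integral_insert[of "UNIV - {i}" i ?g] g by (simp add: I coord_line_def)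
  finally show "(LBINT z. f z) = (LINT w|(\<Pi>\<^sub>M j\<in>UNIV - {i}. lborel). (LBINT t. f (coord_line i w t)))" .
  have [measurable]: "coord_line i w \<in> borel_measurable borel" for w
    by (intro borel_measurable_continuous_onI continuous_on_coord_line)
  have [measurable]: "(\<lambda>x. f (coord_line i (fst x) (snd x))) \<in>
      borel_measurable ((\<Pi>\<^sub>M j\<in>UNIV - {i}. lborel) \<Otimes>\<^sub>M lborel)"
  proof -
    have "(\<lambda>x. f (coord_line i (fst x) (snd x))) = ?g \<circ> (\<lambda>(w, t). w(i := t))"
      by (rule ext) (simp add: coord_line_def split_beta fun_upd_def)
    then show ?thesis
      using measurable_comp[OF measurable_add_dim[of i "UNIV - {i}" "\<lambda>_. lborel", unfolded I]
          borel_measurable_integrable[OF g]] by simp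
  qed
  have "(\<integral>\<^sup>+ w. \<integral>\<^sup>+ t. norm (f (coord_line i w t)) \<partial>lborel \<partial>(\<Pi>\<^sub>M j\<in>UNIV - {i}. lborel))
      = (\<integral>\<^sup>+ w. norm (?g w) \<partial>(\<Pi>\<^sub>M j\<in>UNIV. lborel))"
    using product_nn_integral_insert[of "UNIV - {i}" i "\<lambda>w. ennreal (norm (?g w))"]
      borel_measurable_integrable[OF g] by (simp add: I coord_line_def)
  also have "\<dots> \<noteq> \<infinity>"
    using g by (simp add: integrable_iff_bounded)
  finally have "AE w in (\<Pi>\<^sub>M j\<in>UNIV - {i}. lborel). (\<integral>\<^sup>+ t. norm (f (coord_line i w t)) \<partial>lborel) \<noteq> \<infinity>"
    by (intro nn_integral_PInf_AE) measurable
  then show "AE w in (\<Pi>\<^sub>M j\<in>UNIV - {i}. lborel). integrable lborel (\<lambda>t. f (coord_line i w t))"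
    by eventually_elim (simp add: integrable_iff_bounded less_top)
qed

text \<open>On almost every line in direction \<open>i\<close> both functions are integrable and the
  fundamental theorem relates them, so the one-dimensional lemma makes the inner integral of
  \<open>D\<close> vanish.\<close>

lemma integral_partial_derivative_eq_0:
  fixes F D :: "real^'n \<Rightarrow> real"
  assumes F: "integrable lborel F" and D: "integrable lborel D"
    and FTC: "AE w in (\<Pi>\<^sub>M j\<in>UNIV - {i}. lborel). \<forall>a b. a \<le> b \<longrightarrow>
      F (coord_line i w b) - F (coord_line i w a) = (LBINT t:{a..b}. D (coord_line i w t))"
  shows "(LBINT z. D z) = 0"
proof -
  have "AE w in (\<Pi>\<^sub>M j\<in>UNIV - {i}. lborel). (LBINT t. D (coord_line i w t)) = 0"
    using FTC AE_integrable_coord_line[OF F, of i] AE_integrable_coord_line[OF D, of i]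
  proof eventually_elim
    case (elim w)
    then show ?case
      by (intro integral_derivative_eq_0[where F = "\<lambda>t. F (coord_line i w t)"]) auto
  qed
  then show ?thesis
    unfolding integral_eq_coord_line[OF D, of i] by (rule integral_eq_zero_AE)
qed

section \<open>Derivatives of determinants and inverses\<close>

lemma matrix_inv_left: "invertible A \<Longrightarrow> matrix_inv A ** A = mat 1"
  and matrix_inv_right: "invertible A \<Longrightarrow> A ** matrix_inv A = mat 1"
  for A :: "real^'n^'n"
  unfolding invertible_def matrix_inv_def by (metis (mono_tags, lifting) someI_ex)+

lemma matrix_inv_unique:
  fixes A B :: "real^'n^'n"
  assumes "A ** B = mat 1"
  shows "matrix_inv A = B"
proof -
  have "invertible A"
    using assms invertible_right_inverse by blast
  then have "matrix_inv A ** (A ** B) = B"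
    by (simp add: matrix_mul_assoc matrix_inv_left)
  then show ?thesis using assms by simp
qed

lemma transpose_matrix_inv:
  fixes A :: "real^'n^'n"
  assumes "invertible A"
  shows "matrix_inv (transpose A) = transpose (matrix_inv A)"
  by (rule matrix_inv_unique)
     (simp add: matrix_transpose_mul[symmetric] matrix_inv_left[OF assms] transpose_mat)

lemma inner_matrix_vector_sym:
  fixes A :: "real^'n^'n"
  assumes "transpose A = A"
  shows "x \<bullet> (A *v y) = (A *v x) \<bullet> y"
  by (metis assms dot_lmul_matrix transpose_matrix_vector)

lemma tendsto_det:
  fixes A :: "'b \<Rightarrow> real^'n^'n"
  assumes "\<And>i j. ((\<lambda>t. A t $ i $ j) \<longlongrightarrow> B $ i $ j) F"
  shows "((\<lambda>t. det (A t)) \<longlongrightarrow> det B) F"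
  unfolding det_def by (intro tendsto_intros assms)

section \<open>Invertibility and determinant of positive definite matrices\<close>

lemma sym_pos_def_invertible: "sym_pos_def S \<Longrightarrow> invertible S"
  unfolding invertible_left_inverse matrix_left_invertible_ker sym_pos_def_def
  by (metis inner_zero_right less_irrefl)

lemma sym_pos_def_transpose_matrix_inv:
  "sym_pos_def S \<Longrightarrow> transpose (matrix_inv S) = matrix_inv S"
  using transpose_matrix_inv[OF sym_pos_def_invertible, of S] by (simp add: sym_pos_def_def)

text \<open>Every matrix on the segment from the identity to \<open>S\<close> is positive definite,
  hence has nonzero determinant. The determinant is 1 at the identity, so by the intermediate value
  theorem it stays positive up to \<open>S\<close>.\<close>

lemma sym_pos_def_det_pos:
  fixes S :: "real^'n^'n"
  assumes "sym_pos_def S"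
  shows "det S > 0"
proof (rule ccontr)
  assume neg: "\<not> det S > 0"
  define A where "A t = (1 - t) *\<^sub>R mat 1 + t *\<^sub>R S" for t :: real
  have det_ne: "det (A t) \<noteq> 0" if "0 \<le> t" "t \<le> 1" for t
  proof -
    have "sym_pos_def (A t)"
      unfolding sym_pos_def_def
    proof (intro conjI allI impI)
      show "transpose (A t) = A t"
        using assms by (simp add: A_def sym_pos_def_def transpose_def vec_eq_iff mat_def)
      fix x :: "real^'n" assume "x \<noteq> 0"
      then have "x \<bullet> (S *v x) > 0" "x \<bullet> x > 0"
        using assms by (auto simp: sym_pos_def_def)
      moreover have "x \<bullet> (A t *v x) = (1 - t) * (x \<bullet> x) + t * (x \<bullet> (S *v x))"
        by (simp add: A_def matrix_vector_mult_add_rdistrib inner_add_right scaleR_matrix_vector_assoc[symmetric])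
      ultimately show "0 < x \<bullet> (A t *v x)"
        using that by (cases "t = 0") (auto intro: add_nonneg_pos)
    qed
    then show ?thesis
      using sym_pos_def_invertible invertible_det_nz by blast
  qed
  have "continuous_on {0..1} (\<lambda>t. det (A t))"
    unfolding continuous_on_def by (intro ballI tendsto_det) (auto simp: A_def intro!: tendsto_intros)
  then obtain t where "0 \<le> t" "t \<le> 1" "det (A t) = 0"
    using IVT2'[of "\<lambda>t. det (A t)" 1 0 0] neg by (auto simp: A_def)
  then show False using det_ne by blast
qed

text \<open>Each product in the Leibniz formula is differentiated factor by factor. At the identity
  matrix only the identity permutation contributes, and it contributes the trace.\<close>

lemma has_real_derivative_det_id:
  fixes M :: "real^'n^'n"
  shows "((\<lambda>t. det (mat 1 + t *\<^sub>R M)) has_real_derivative trace M) (at 0)"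
proof -
  let ?U = "UNIV :: 'n set"
  \<comment> \<open>The remaining factors are nonzero only if \<open>p\<close> fixes every index
    other than \<open>i\<close>; a permutation that does so also fixes \<open>i\<close>.\<close>
  have prod_id: "(\<Prod>j\<in>?U - {i}. (mat 1 :: real^'n^'n) $ j $ p j) = (if p = id then 1 else 0)"
    if p: "p permutes ?U" for p and i :: 'n
  proof (cases "\<forall>j. j \<noteq> i \<longrightarrow> p j = j")
    case True
    then have "p i = i"
      using p by (metis permutes_def)
    then show ?thesis using True by (auto simp: mat_def fun_eq_iff)
  next
    case False
    then show ?thesis
      by (auto simp: mat_def)
  qed
  have "((\<lambda>t. det (mat 1 + t *\<^sub>R M)) has_real_derivative
      (\<Sum>p\<in>{p. p permutes ?U}. of_int (sign p) *
         (\<Sum>i\<in>?U. M $ i $ p i * (\<Prod>j\<in>?U - {i}. (mat 1 + 0 *\<^sub>R M) $ j $ p j)))) (at 0)"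
    unfolding det_def
  proof (intro DERIV_sum DERIV_cmult has_field_derivative_prod)
    show "((\<lambda>t. (mat 1 + t *\<^sub>R M) $ i $ p i) has_real_derivative M $ i $ p i) (at 0)" for p :: "'n \<Rightarrow> 'n" and i
      by (auto intro!: derivative_eq_intros)
  qed
  also have "(\<Sum>p\<in>{p. p permutes ?U}. of_int (sign p) *
         (\<Sum>i\<in>?U. M $ i $ p i * (\<Prod>j\<in>?U - {i}. (mat 1 + 0 *\<^sub>R M) $ j $ p j)))
      = (\<Sum>p\<in>{p. p permutes ?U}. if p = id then trace M else 0)"
    by (intro sum.cong) (auto simp: prod_id trace_def)
  also have "\<dots> = trace M"
    by (simp add: permutes_id finite_permutations)
  finally show ?thesis .
qed

text \<open>Jacobi's formula, reduced to the case of the identity by factoring \<open>A\<close> out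
  of \<open>A + t *\<^sub>R H\<close>.\<close>

lemma has_real_derivative_det:
  fixes A H :: "real^'n^'n"
  assumes "invertible A"
  shows "((\<lambda>t. det (A + t *\<^sub>R H)) has_real_derivative det A * trace (matrix_inv A ** H)) (at 0)"
proof -
  have "det (A + t *\<^sub>R H) = det A * det (mat 1 + t *\<^sub>R (matrix_inv A ** H))" for t
  proof -
    have "A ** (mat 1 + t *\<^sub>R (matrix_inv A ** H)) = A + t *\<^sub>R H"
      by (simp add: matrix_add_ldistrib matrix_scalar_ac scalar_matrix_assoc[symmetric] matrix_mul_assoc matrix_inv_right[OF assms])
    then show ?thesis by (metis det_mul)
  qed
  then show ?thesis
    using DERIV_cmult[OF has_real_derivative_det_id[of "matrix_inv A ** H"], of "det A"] by simp
qed

lemma tendsto_add_scaleR_component: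
  fixes A H :: "real^'n^'n"
  shows "((\<lambda>t. (A + t *\<^sub>R H) $ i $ j) \<longlongrightarrow> A $ i $ j) (at 0)"
  by (auto intro!: tendsto_eq_intros)

lemma eventually_invertible_add_scaleR:
  fixes A H :: "real^'n^'n"
  assumes "invertible A"
  shows "\<forall>\<^sub>F t in at 0. invertible (A + t *\<^sub>R H)"
  unfolding invertible_det_nz
  by (rule tendsto_imp_eventually_ne[OF tendsto_det[OF tendsto_add_scaleR_component]])
     (use assms in \<open>simp add: invertible_det_nz\<close>)

text \<open>Cramer's rule writes each component as a quotient of determinants, so continuity of the
  determinant suffices; the matrices stay invertible for \<open>t\<close> near 0.\<close>

lemma tendsto_matrix_inv_vec:
  fixes A H :: "real^'n^'n"
  assumes "invertible A"
  shows "((\<lambda>t. matrix_inv (A + t *\<^sub>R H) *v x) \<longlongrightarrow> matrix_inv A *v x) (at 0)"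
proof -
  let ?c = "\<lambda>A. (\<chi> k. det (\<chi> i j. if j = k then x $ i else A $ i $ j) / det A) :: real^'n"
  have eq: "matrix_inv B *v x = ?c B" if "invertible B" for B
  proof -
    have "B *v (matrix_inv B *v x) = x"
      using that by (simp add: matrix_vector_mul_assoc matrix_inv_right)
    then show ?thesis
      using cramer that unfolding invertible_det_nz by blast
  qed
  have "((\<lambda>t. det (\<chi> i j. if j = k then x $ i else (A + t *\<^sub>R H) $ i $ j)) \<longlongrightarrow>
      det (\<chi> i j. if j = k then x $ i else A $ i $ j)) (at 0)" for k
  proof (rule tendsto_det)
    show "((\<lambda>t. (\<chi> i j. if j = k then x $ i else (A + t *\<^sub>R H) $ i $ j) $ i $ j) \<longlongrightarrow>
        (\<chi> i j. if j = k then x $ i else A $ i $ j) $ i $ j) (at 0)" for i j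
      using tendsto_add_scaleR_component[of A H i j] by (cases "j = k") auto
  qed
  then have "((\<lambda>t. ?c (A + t *\<^sub>R H)) \<longlongrightarrow> ?c A) (at 0)"
    using assms tendsto_det[OF tendsto_add_scaleR_component] unfolding invertible_det_nz
    by (intro tendsto_vec_lambda tendsto_divide) auto
  moreover have "\<forall>\<^sub>F t in at 0. ?c (A + t *\<^sub>R H) = matrix_inv (A + t *\<^sub>R H) *v x"
    using eventually_invertible_add_scaleR[OF assms, of H] by eventually_elim (simp add: eq)
  ultimately show ?thesis
    unfolding eq[OF assms] by (rule Lim_transform_eventually)
qed

text \<open>With \<open>B = A + t *\<^sub>R H\<close>, applying the inverse of \<open>B\<close> to
  \<open>B *v (matrix_inv A *v x)\<close> shows that the difference quotient equals
  \<open>- (x \<bullet> (matrix_inv B *v (H *v (matrix_inv A *v x))))\<close> exactly. Only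
  continuity of the inverse is then left to use.\<close>

lemma has_real_derivative_quadratic_inv:
  fixes A H :: "real^'n^'n"
  assumes "invertible A"
  shows "((\<lambda>t. x \<bullet> (matrix_inv (A + t *\<^sub>R H) *v x)) has_real_derivative
           - (x \<bullet> (matrix_inv A *v (H *v (matrix_inv A *v x))))) (at 0)"
proof -
  let ?y = "H *v (matrix_inv A *v x)"
  have "((\<lambda>t. - (x \<bullet> (matrix_inv (A + t *\<^sub>R H) *v ?y))) \<longlongrightarrow> - (x \<bullet> (matrix_inv A *v ?y))) (at 0)"
    by (intro tendsto_intros tendsto_matrix_inv_vec assms)
  moreover have "\<forall>\<^sub>F t in at 0. - (x \<bullet> (matrix_inv (A + t *\<^sub>R H) *v ?y)) =
      (x \<bullet> (matrix_inv (A + t *\<^sub>R H) *v x) - x \<bullet> (matrix_inv A *v x)) / t"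
    using eventually_invertible_add_scaleR[OF assms, of H]
    using eventually_neq_at_within[of 0]
  proof eventually_elim
    case (elim t)
    let ?B = "matrix_inv (A + t *\<^sub>R H)"
    have "?B *v ((A + t *\<^sub>R H) *v (matrix_inv A *v x)) = matrix_inv A *v x"
      by (simp only: matrix_vector_mul_assoc matrix_mul_assoc matrix_inv_left[OF elim(1)] matrix_mul_lid)
    moreover have "(A + t *\<^sub>R H) *v (matrix_inv A *v x) = x + t *\<^sub>R ?y"
      by (simp add: matrix_vector_mult_add_rdistrib scaleR_matrix_vector_assoc[symmetric])
         (simp add: matrix_vector_mul_assoc matrix_inv_right[OF assms])
    ultimately have "?B *v x + t *\<^sub>R (?B *v ?y) = matrix_inv A *v x"
      by (simp add: matrix_vector_right_distrib matrix_vector_mult_scaleR)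
    then have "x \<bullet> (matrix_inv A *v x) = x \<bullet> (?B *v x) + t * (x \<bullet> (?B *v ?y))"
      by (metis inner_add_right inner_scaleR_right)
    then show ?case using elim(2) by simp
  qed
  ultimately have "((\<lambda>t. (x \<bullet> (matrix_inv (A + t *\<^sub>R H) *v x) - x \<bullet> (matrix_inv A *v x)) / t)
      \<longlongrightarrow> - (x \<bullet> (matrix_inv A *v ?y))) (at 0)"
    by (rule Lim_transform_eventually)
  then show ?thesis by (simp add: DERIV_def)
qed

section \<open>The trace pairing and uniqueness of the symmetric gradient\<close>

lemma trace_outer_mult: "trace (outer u v ** H) = u \<bullet> (transpose H *v v)"
  for u v :: "real^'n"
  by (simp add: trace_def outer_def matrix_matrix_mult_def inner_vec_def matrix_vector_mult_def
      transpose_def sum_distrib_left mult_ac del: transpose_matrix_vector)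

lemma trace_transpose_mult_self: "trace (transpose A ** A) = A \<bullet> A"
  for A :: "real^'n^'n"
  by (simp add: trace_def matrix_matrix_mult_def inner_vec_def transpose_def)
     (rule sum.swap)

lemma trace_scaleR_diff_mult:
  fixes A B C :: "real^'n^'n"
  shows "trace ((c *\<^sub>R (A - B)) ** C) = c * (trace (A ** C) - trace (B ** C))"
  by (simp add: trace_def matrix_matrix_mult_def sum_subtractf left_diff_distrib right_diff_distrib
      sum_distrib_left mult.assoc)

text \<open>The difference of two gradients is itself a symmetric direction. Pairing it with itself
  gives its squared Frobenius norm, which is therefore 0.\<close>

lemma has_sym_grad_unique:
  assumes "has_sym_grad F G S" "has_sym_grad F G' S"
  shows "G = G'"
proof -
  define H where "H = G - G'"
  have sym: "transpose H = H"
    using assms unfolding has_sym_grad_def H_def by (simp add: transpose_def vec_eq_iff)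
  then have "trace (G ** H) = trace (G' ** H)"
    using assms unfolding has_sym_grad_def by (blast intro: DERIV_unique)
  then have "trace (H ** H) = 0"
    using trace_scaleR_diff_mult[of 1 G G' H] by (simp add: H_def)
  then have "H \<bullet> H = 0"
    using trace_transpose_mult_self[of H] sym by simp
  then show ?thesis by (simp add: H_def)
qed

lemma sym_grad_eqI: "has_sym_grad F G S \<Longrightarrow> sym_grad F S = G"
  unfolding sym_grad_def by (blast intro: the_equality has_sym_grad_unique)

section \<open>Derivatives of the Gaussian density\<close>

lemma gauss_density_pos: "sym_pos_def S \<Longrightarrow> gauss_density \<mu> S z > 0"
  by (simp add: gauss_density_def sym_pos_def_det_pos)

text \<open>The shape of the density along a line of covariance matrices: \<open>Q\<close> is the
  quadratic form, \<open>d\<close> the determinant, \<open>c\<close> the power of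
  \<open>2 * pi\<close>. The derivative of \<open>d\<close> is written \<open>D * T\<close> to match
  Jacobi's formula, so that \<open>D\<close> cancels.\<close>

lemma has_real_derivative_exp_div_sqrt:
  fixes Q d :: "real \<Rightarrow> real"
  assumes Q: "(Q has_real_derivative Q') (at x)" and d: "(d has_real_derivative D * T) (at x)"
    and D: "d x = D" and pos: "c > 0" "D > 0"
  shows "((\<lambda>t. exp (- Q t / 2) / sqrt (c * d t)) has_real_derivative
           exp (- Q x / 2) / sqrt (c * D) / 2 * (- Q' - T)) (at x)"
proof (rule DERIV_cong)
  define r where "r = sqrt (c * D)"
  have r: "r > 0" "c * D = r * r"
    using pos by (simp_all add: r_def)
  show "((\<lambda>t. exp (- Q t / 2) / sqrt (c * d t)) has_real_derivative
      (exp (- Q x / 2) * (- Q' / 2) * sqrt (c * D) - exp (- Q x / 2) * (c * (D * T) * (inverse (sqrt (c * D)) / 2)))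
        / (sqrt (c * D) * sqrt (c * D))) (at x)"
    using mult_pos_pos[OF pos] by (auto intro!: derivative_eq_intros Q d simp: D)
  show "(exp (- Q x / 2) * (- Q' / 2) * sqrt (c * D) - exp (- Q x / 2) * (c * (D * T) * (inverse (sqrt (c * D)) / 2)))
        / (sqrt (c * D) * sqrt (c * D)) = exp (- Q x / 2) / sqrt (c * D) / 2 * (- Q' - T)"
    using r(1) unfolding r_def[symmetric] mult.assoc[symmetric] r(2)
    by (simp add: field_simps)
qed

text \<open>In direction \<open>H\<close> the exponent contributes
  \<open>v \<bullet> (H *v v)\<close>, which is the trace pairing of \<open>outer v v\<close> with
  \<open>H\<close>, and the determinant contributes \<open>- trace (matrix_inv S ** H)\<close>.
  Since the inverse is symmetric, this is the usual formula with \<open>S\<close> inverted on both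
  sides of the bracket.\<close>

lemma sym_grad_gauss_density:
  fixes \<mu> z :: "real^'n" and S :: "real^'n^'n"
  assumes S: "sym_pos_def S"
  defines "v \<equiv> matrix_inv S *v (z - \<mu>)"
  shows "sym_grad (\<lambda>S'. gauss_density \<mu> S' z) S =
           (gauss_density \<mu> S z / 2) *\<^sub>R (outer v v - matrix_inv S)"
proof (rule sym_grad_eqI, unfold has_sym_grad_def, intro conjI allI impI)
  note inv = sym_pos_def_invertible[OF S]
  note St = sym_pos_def_transpose_matrix_inv[OF S]
  show "transpose ((gauss_density \<mu> S z / 2) *\<^sub>R (outer v v - matrix_inv S)) =
    (gauss_density \<mu> S z / 2) *\<^sub>R (outer v v - matrix_inv S)"
    using St by (simp add: vec_eq_iff transpose_def outer_def)
  fix H :: "real^'n^'n" assume H: "transpose H = H"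
  define x where "x = z - \<mu>"
  define c where "c = (2 * pi) ^ CARD('n)"
  have c: "c > 0" by (simp add: c_def)
  note det = sym_pos_def_det_pos[OF S]
  have quad: "x \<bullet> (matrix_inv S *v (H *v (matrix_inv S *v x))) = v \<bullet> (H *v v)"
    by (simp add: v_def x_def inner_matrix_vector_sym[OF St])
  have tr: "trace ((gauss_density \<mu> S z / 2) *\<^sub>R (outer v v - matrix_inv S) ** H) =
      gauss_density \<mu> S z / 2 * (v \<bullet> (H *v v) - trace (matrix_inv S ** H))"
    by (simp add: trace_scaleR_diff_mult trace_outer_mult H del: transpose_matrix_vector)
  show "((\<lambda>t. gauss_density \<mu> (S + t *\<^sub>R H) z) has_real_derivative
      trace ((gauss_density \<mu> S z / 2) *\<^sub>R (outer v v - matrix_inv S) ** H)) (at 0)"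
    using has_real_derivative_exp_div_sqrt[OF has_real_derivative_quadratic_inv[OF inv, of x H]
        has_real_derivative_det[OF inv, of H] _ c det]
    unfolding tr unfolding quad gauss_density_def x_def[symmetric] c_def[symmetric]
    by simp
qed

section \<open>Spatial derivatives, also along coordinate lines\<close>

lemma coord_line_add: "coord_line i w (t + s) = coord_line i w t + s *\<^sub>R axis i 1"
  by (auto simp: coord_line_def vec_eq_iff axis_def)

lemma has_vector_derivative_coord_line: "(coord_line i w has_vector_derivative axis i 1) (at t)"
proof -
  have eq: "coord_line i w = (\<lambda>t. coord_line i w 0 + t *\<^sub>R axis i 1)"
    using coord_line_add[of i w 0] by (intro ext) (metis add_0)
  show ?thesis
    by (subst eq) (auto intro!: derivative_eq_intros)
qed

lemma has_real_derivative_coord_line: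
  fixes f :: "real^'n \<Rightarrow> real"
  assumes "(f has_derivative f') (at (coord_line i w t))"
  shows "((\<lambda>t. f (coord_line i w t)) has_real_derivative f' (axis i 1)) (at t)"
proof -
  interpret linear f'
    using assms by (rule has_derivative_linear)
  have "((\<lambda>t. f (coord_line i w t)) has_derivative (\<lambda>s. f' (s *\<^sub>R axis i 1))) (at t)"
    using has_derivative_compose[OF has_vector_derivative_coord_line[unfolded has_vector_derivative_def] assms] .
  then show ?thesis
    by (simp add: has_field_derivative_def scale mult.commute[of _ "f' (axis i 1)"])
qed

text \<open>Translating the parameter turns one derivative predicate into the other, so the values
  of \<open>deriv\<close> agree even where no derivative exists.\<close>

lemma partial_deriv_coord_line:
  "partial_deriv i f (coord_line i w t) = deriv (\<lambda>s. f (coord_line i w s)) t"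
  unfolding partial_deriv_def deriv_def coord_line_add[symmetric]
  using DERIV_shift[of "\<lambda>s. f (coord_line i w s)" _ 0 t] by (simp add: add.commute)

text \<open>Justifies the definite description in \<open>grad\<close>: the adjoint of the
  derivative, evaluated at 1, represents it as an inner product, and two representing vectors agree
  when tested against their difference.\<close>

lemma has_derivative_grad:
  assumes "continuously_differentiable h"
  shows "(h has_derivative (\<lambda>v. v \<bullet> grad h z)) (at z)"
proof -
  obtain f' where f': "(h has_derivative f') (at z)"
    using assms unfolding continuously_differentiable_def differentiable_def by blast
  then interpret linear f' by (rule has_derivative_linear)
  have "f' v = v \<bullet> adjoint f' 1" for v
    using adjoint_works[of f' v 1] linear_axioms by simp
  then have "GDERIV h z :> adjoint f' 1"
    using f' unfolding gderiv_def by (metis (no_types) ext)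
  moreover have "D = D'" if "GDERIV h z :> D" "GDERIV h z :> D'" for D D'
  proof -
    have "(\<lambda>v. v \<bullet> D) = (\<lambda>v. v \<bullet> D')"
      using that unfolding gderiv_def by (rule has_derivative_unique)
    then have "(D - D') \<bullet> D = (D - D') \<bullet> D'"
      by (rule fun_cong)
    then have "(D - D') \<bullet> (D - D') = 0"
      unfolding inner_diff_right[of "D - D'"] by simp
    then show ?thesis by simp
  qed
  ultimately have "\<exists>!D. GDERIV h z :> D"
    by blast
  then have "GDERIV h z :> grad h z"
    unfolding grad_def by (rule theI')
  then show ?thesis by (simp add: gderiv_def)
qed

lemma has_derivative_gauss_density:
  fixes \<mu> :: "real^'n" and S :: "real^'n^'n"
  assumes S: "sym_pos_def S"
  shows "(gauss_density \<mu> S has_derivative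
    (\<lambda>v. - gauss_density \<mu> S z * (v \<bullet> (matrix_inv S *v (z - \<mu>))))) (at z)"
proof -
  note St = sym_pos_def_transpose_matrix_inv[OF S]
  have [derivative_intros]: "((\<lambda>z. matrix_inv S *v (z - \<mu>)) has_derivative (\<lambda>v. matrix_inv S *v v)) (at z)"
    by (rule derivative_eq_intros bounded_linear.has_derivative[OF matrix_vector_mul_bounded_linear] refl | simp)+
  define c where "c = sqrt ((2 * pi) ^ CARD('n) * det S)"
  have c: "c > 0"
    by (simp add: c_def sym_pos_def_det_pos[OF S])
  have "((\<lambda>z. exp (- ((z - \<mu>) \<bullet> (matrix_inv S *v (z - \<mu>))) / 2) / c) has_derivative
     (\<lambda>v. exp (- ((z - \<mu>) \<bullet> (matrix_inv S *v (z - \<mu>))) / 2) *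
       (- ((z - \<mu>) \<bullet> (matrix_inv S *v v) + v \<bullet> (matrix_inv S *v (z - \<mu>))) / 2) / c)) (at z)"
    using c by (auto intro!: derivative_eq_intros simp: fun_eq_iff field_simps)
  also have "(\<lambda>v. exp (- ((z - \<mu>) \<bullet> (matrix_inv S *v (z - \<mu>))) / 2) *
       (- ((z - \<mu>) \<bullet> (matrix_inv S *v v) + v \<bullet> (matrix_inv S *v (z - \<mu>))) / 2) / c)
     = (\<lambda>v. - (exp (- ((z - \<mu>) \<bullet> (matrix_inv S *v (z - \<mu>))) / 2) / c) *
         (v \<bullet> (matrix_inv S *v (z - \<mu>))))"
  proof
    fix v
    \<comment> \<open>Symmetry of the inverse merges the two terms of the product rule, which
      absorbs the factor 1/2.\<close>
    have "(z - \<mu>) \<bullet> (matrix_inv S *v v) = v \<bullet> (matrix_inv S *v (z - \<mu>))"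
      by (metis inner_matrix_vector_sym[OF St] inner_commute)
    then show "exp (- ((z - \<mu>) \<bullet> (matrix_inv S *v (z - \<mu>))) / 2) *
       (- ((z - \<mu>) \<bullet> (matrix_inv S *v v) + v \<bullet> (matrix_inv S *v (z - \<mu>))) / 2) / c
     = - (exp (- ((z - \<mu>) \<bullet> (matrix_inv S *v (z - \<mu>))) / 2) / c) *
         (v \<bullet> (matrix_inv S *v (z - \<mu>)))"
      by simp
  qed
  finally show ?thesis
    unfolding gauss_density_def c_def[symmetric] by simp
qed

text \<open>Translates \<open>AC_on\<close>, stated for Lebesgue measure and the derivative within
  the interval, into a statement about \<open>lborel\<close> and the two-sided \<open>deriv\<close>
  of one component. The derivatives agree almost everywhere, and the assumed Borel measurability
  lets the integrals descend from the completion.\<close>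

lemma AC_on_component:
  fixes g :: "real \<Rightarrow> real^'n"
  assumes AC: "AC_on a b g" and e[measurable]: "(\<lambda>t. deriv (\<lambda>s. g s $ j) t) \<in> borel_measurable borel"
  shows "set_integrable lborel {a..b} (\<lambda>t. deriv (\<lambda>s. g s $ j) t)"
    and "x \<in> {a..b} \<Longrightarrow> g x $ j = g a $ j + (LBINT t:{a..x}. deriv (\<lambda>s. g s $ j) t)"
proof -
  define e where "e t = deriv (\<lambda>s. g s $ j) t" for t
  have [measurable]: "e \<in> borel_measurable borel"
    using e by (simp add: e_def[abs_def])
  let ?v = "\<lambda>t. vector_derivative g (at t within {a..b})"
  \<comment> \<open>Discards the endpoints, where the derivative within the interval is
    one-sided.\<close>
  have "AE t in lebesgue. t \<noteq> c" for c :: real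
    by (intro AE_completion AE_lborel_singleton)
  from this[of a] this[of b] AC[unfolded AC_on_def, THEN conjunct1]
  have ae: "AE t in lebesgue. t \<in> {a..b} \<longrightarrow> e t = ?v t $ j"
  proof eventually_elim
    case (elim t)
    show ?case
    proof
      assume t: "t \<in> {a..b}"
      then have "(g has_vector_derivative ?v t) (at t within {a..b})"
        using elim by (simp add: vector_derivative_works)
      moreover have "at t within {a..b} = at t"
        using elim t by (intro at_within_Icc_at) auto
      ultimately have "(g has_vector_derivative ?v t) (at t)"
        by simp
      then have "((\<lambda>s. g s $ j) has_vector_derivative ?v t $ j) (at t)"
        by (rule bounded_linear.has_vector_derivative[OF bounded_linear_vec_nth])
      then show "e t = ?v t $ j"
        unfolding e_def by (simp add: DERIV_imp_deriv has_real_derivative_iff_has_vector_derivative)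
    qed
  qed
  have key: "integrable lborel (\<lambda>t. indicator {a..x} t *\<^sub>R e t)"
    "(LBINT t:{a..x}. e t) = (LINT t:{a..x}|lebesgue. ?v t) $ j" if x: "x \<in> {a..b}" for x
  proof -
    have "set_integrable lebesgue {a..b} ?v"
      using AC by (simp add: AC_on_def)
    then have "set_integrable lebesgue {a..x} ?v"
      by (rule set_integrable_subset) (use x in auto)
    then have v: "integrable lebesgue (\<lambda>t. indicator {a..x} t *\<^sub>R ?v t)"
      by (simp add: set_integrable_def)
    have ae': "AE t in lebesgue. (indicator {a..x} t *\<^sub>R ?v t) $ j = indicator {a..x} t *\<^sub>R e t"
      using ae by eventually_elim (use x in \<open>auto simp: indicator_def\<close>)
    have m: "(\<lambda>t. indicator {a..x} t *\<^sub>R e t) \<in> borel_measurable lborel"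
      by measurable
    have m': "(\<lambda>t. indicator {a..x} t *\<^sub>R e t) \<in> borel_measurable lebesgue"
      by (rule measurable_completion[OF m])
    have vj: "integrable lebesgue (\<lambda>t. (indicator {a..x} t *\<^sub>R ?v t) $ j)"
      by (rule integrable_bounded_linear[OF bounded_linear_vec_nth v])
    then have "integrable lebesgue (\<lambda>t. indicator {a..x} t *\<^sub>R e t)"
      using integrable_cong_AE_imp[OF vj m'] ae' by auto
    then show "integrable lborel (\<lambda>t. indicator {a..x} t *\<^sub>R e t)"
      using integrable_completion[OF m] by simp
    have "(LBINT t:{a..x}. e t) = (LINT t|lebesgue. indicator {a..x} t *\<^sub>R e t)"
      unfolding set_lebesgue_integral_def by (rule integral_completion[OF m, symmetric])
    also have "\<dots> = (LINT t|lebesgue. (indicator {a..x} t *\<^sub>R ?v t) $ j)"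
      using ae' vj m' by (intro integral_cong_AE) auto
    also have "\<dots> = (LINT t:{a..x}|lebesgue. ?v t) $ j"
      unfolding set_lebesgue_integral_def by (rule integral_bounded_linear[OF bounded_linear_vec_nth v])
    finally show "(LBINT t:{a..x}. e t) = (LINT t:{a..x}|lebesgue. ?v t) $ j" .
  qed
  show "set_integrable lborel {a..b} (\<lambda>t. deriv (\<lambda>s. g s $ j) t)"
  proof (cases "a \<le> b")
    case True
    then show ?thesis using key(1)[of b] by (simp add: set_integrable_def e_def)
  qed (simp add: set_integrable_def)
  assume x: "x \<in> {a..b}"
  then have "g x = g a + (LINT t:{a..x}|lebesgue. ?v t)"
    using AC unfolding AC_on_def by blast
  then have "g x $ j = g a $ j + (LINT t:{a..x}|lebesgue. ?v t) $ j"
    by simp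
  then show "g x $ j = g a $ j + (LBINT t:{a..x}. deriv (\<lambda>s. g s $ j) t)"
    using key(2)[OF x] by (simp add: e_def)
qed

section \<open>Gaussian expectations as Lebesgue integrals\<close>

lemma continuous_on_gauss_density: "sym_pos_def S \<Longrightarrow> continuous_on A (gauss_density \<mu> S)"
  by (intro continuous_at_imp_continuous_on ballI)
     (rule has_derivative_continuous[OF has_derivative_gauss_density])

lemma
  fixes f :: "real^'n \<Rightarrow> real"
  assumes S: "sym_pos_def S" and f: "f \<in> borel_measurable borel"
  shows integrable_gauss_iff: "integrable (gauss \<mu> S) f \<longleftrightarrow> integrable lborel (\<lambda>z. gauss_density \<mu> S z * f z)"
    and integral_gauss: "integral\<^sup>L (gauss \<mu> S) f = (LBINT z. gauss_density \<mu> S z * f z)"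
proof -
  have f: "f \<in> borel_measurable lborel"
    using f by simp
  have q: "gauss_density \<mu> S \<in> borel_measurable lborel"
    using borel_measurable_continuous_onI[OF continuous_on_gauss_density[OF S]] by simp
  have nonneg: "AE z in lborel. 0 \<le> gauss_density \<mu> S z"
    using gauss_density_pos[OF S] by (simp add: less_imp_le)
  show "integrable (gauss \<mu> S) f \<longleftrightarrow> integrable lborel (\<lambda>z. gauss_density \<mu> S z * f z)"
    unfolding gauss_def integrable_density[OF f q nonneg] by simp
  show "integral\<^sup>L (gauss \<mu> S) f = (LBINT z. gauss_density \<mu> S z * f z)"
    unfolding gauss_def integral_density[OF f q nonneg] by simp
qed

lemma bounded_linear_matrix_nth: "bounded_linear (\<lambda>A :: real^'n^'m. A $ i $ j)"
  by (rule bounded_linear_compose[OF bounded_linear_vec_nth bounded_linear_vec_nth])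

lemmas integrable_matrix_nth = integrable_bounded_linear[OF bounded_linear_matrix_nth]
lemmas integral_matrix_nth = integral_bounded_linear[OF bounded_linear_matrix_nth]

section \<open>Gaussian integration by parts\<close>

lemma sets_gauss [measurable_cong, simp]: "sets (gauss \<mu> S) = sets borel"
  by (simp add: gauss_def)

lemma continuous_on_affine_component:
  fixes A :: "real^'n^'m"
  shows "continuous_on X (\<lambda>z. (A *v (z - \<mu>)) $ i)"
  by (intro continuous_on_component bounded_linear.continuous_on[OF matrix_vector_mul_bounded_linear]
      continuous_intros)

text \<open>Here \<open>e\<close> stands for the partial derivative of \<open>f\<close> in direction
  \<open>i\<close>. Since that of the density \<open>q\<close> is \<open>- q\<close> times the
  \<open>i\<close>-th component of \<open>matrix_inv S *v (z - \<mu>)\<close>, the difference of the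
  two integrands, times \<open>q\<close>, is the derivative of \<open>q * f\<close> along lines and
  integrates to 0.\<close>

lemma gauss_integration_by_parts:
  fixes \<mu> :: "real^'n" and S :: "real^'n^'n" and f e :: "real^'n \<Rightarrow> real"
  assumes S: "sym_pos_def S"
    and f: "integrable (gauss \<mu> S) f" and e: "integrable (gauss \<mu> S) e"
    and xf: "integrable (gauss \<mu> S) (\<lambda>z. (matrix_inv S *v (z - \<mu>)) $ i * f z)"
    and AC: "AE w in (\<Pi>\<^sub>M j\<in>UNIV - {i}. lborel). \<forall>a b. a \<le> b \<longrightarrow>
      set_integrable lborel {a..b} (\<lambda>t. e (coord_line i w t)) \<and>
      (\<forall>y\<in>{a..b}. f (coord_line i w y) = f (coord_line i w a) + (LBINT t:{a..y}. e (coord_line i w t)))"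
  shows "integral\<^sup>L (gauss \<mu> S) e = integral\<^sup>L (gauss \<mu> S) (\<lambda>z. (matrix_inv S *v (z - \<mu>)) $ i * f z)"
proof -
  let ?q = "gauss_density \<mu> S" and ?x = "\<lambda>z. (matrix_inv S *v (z - \<mu>)) $ i"
  have meas: "f \<in> borel_measurable borel" "e \<in> borel_measurable borel"
    "(\<lambda>z. ?x z * f z) \<in> borel_measurable borel"
    using borel_measurable_integrable[OF f] borel_measurable_integrable[OF e]
      borel_measurable_integrable[OF xf]
    by (simp_all cong: measurable_cong_sets)
  have qf: "integrable lborel (\<lambda>z. ?q z * f z)" and qe: "integrable lborel (\<lambda>z. ?q z * e z)"
    and qxf: "integrable lborel (\<lambda>z. ?q z * (?x z * f z))"
    using f e xf unfolding integrable_gauss_iff[OF S meas(1)] integrable_gauss_iff[OF S meas(2)]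
      integrable_gauss_iff[OF S meas(3)] by auto
  have "(LBINT z. ?q z * e z - ?q z * (?x z * f z)) = 0"
  proof (rule integral_partial_derivative_eq_0[OF qf Bochner_Integration.integrable_diff[OF qe qxf], of i])
    show "AE w in (\<Pi>\<^sub>M j\<in>UNIV - {i}. lborel). \<forall>a b. a \<le> b \<longrightarrow>
      ?q (coord_line i w b) * f (coord_line i w b) - ?q (coord_line i w a) * f (coord_line i w a) =
      (LBINT t:{a..b}. ?q (coord_line i w t) * e (coord_line i w t)
         - ?q (coord_line i w t) * (?x (coord_line i w t) * f (coord_line i w t)))"
      using AC
    proof eventually_elim
      case (elim w)
      let ?l = "coord_line i w"
      have q: "((\<lambda>t. ?q (?l t)) has_real_derivative - ?q (?l t) * ?x (?l t)) (at t)" for t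
        using has_real_derivative_coord_line[OF has_derivative_gauss_density[OF S]]
        by (simp add: inner_axis')
      have "continuous_on UNIV (\<lambda>z. - ?q z * ?x z)"
        by (intro continuous_on_mult continuous_on_minus continuous_on_gauss_density[OF S]
            continuous_on_affine_component)
      from continuous_on_compose2[OF this continuous_on_coord_line subset_UNIV]
      have q': "continuous_on UNIV (\<lambda>t. - ?q (?l t) * ?x (?l t))" .
      show ?case
      proof (intro allI impI)
        fix a b :: real assume "a \<le> b"
        note elim = elim[rule_format, OF this]
        have d: "set_integrable lborel {a..b} (\<lambda>t. e (?l t))"
          and fd: "\<And>y. y \<in> {a..b} \<Longrightarrow> f (?l y) = f (?l a) + (LBINT t:{a..y}. e (?l t))"
          using conjunct1[OF elim] conjunct2[OF elim] by blast+
        show "?q (?l b) * f (?l b) - ?q (?l a) * f (?l a) =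
            (LBINT t:{a..b}. ?q (?l t) * e (?l t) - ?q (?l t) * (?x (?l t) * f (?l t)))"
          using integral_by_parts_AC[OF \<open>a \<le> b\<close> d fd q q'] by (simp add: mult_ac)
      qed
    qed
  qed
  then show ?thesis
    using qe qxf by (simp add: integral_gauss[OF S] meas)
qed

lemma continuous_on_continuously_differentiable:
  assumes "continuously_differentiable h"
  shows "continuous_on X h"
  using has_derivative_grad[OF assms]
  by (intro continuous_at_imp_continuous_on ballI) (rule has_derivative_continuous)

lemma continuous_on_grad_component:
  assumes "continuously_differentiable h"
  shows "continuous_on X (\<lambda>z. grad h z $ j)"
  using assms unfolding continuously_differentiable_def
  by (intro continuous_on_component) (blast intro: continuous_on_subset)

text \<open>Integration by parts in direction \<open>j\<close> for \<open>x z $ i * h z\<close>. The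
  hypothesis \<open>int_xxh\<close> ranges over all pairs because the diagonal pair at
  \<open>i\<close> bounds this function.\<close>

lemma integral_gauss_second_moment_eq_grad:
  fixes \<mu> :: "real^'n" and S :: "real^'n^'n" and h :: "real^'n \<Rightarrow> real"
  defines "x z \<equiv> matrix_inv S *v (z - \<mu>)"
  assumes S: "sym_pos_def S" and h: "continuously_differentiable h"
    and int_h: "integrable (gauss \<mu> S) h"
    and int_xg: "integrable (gauss \<mu> S) (\<lambda>z. x z $ i * grad h z $ j)"
    and int_xxh: "\<And>i j. integrable (gauss \<mu> S) (\<lambda>z. x z $ i * x z $ j * h z)"
  shows "integral\<^sup>L (gauss \<mu> S) (\<lambda>z. (x z $ i * x z $ j - matrix_inv S $ i $ j) * h z) =
         integral\<^sup>L (gauss \<mu> S) (\<lambda>z. x z $ i * grad h z $ j)"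
proof -
  have x_cont: "continuous_on X (\<lambda>z. x z $ i)" for X i
    unfolding x_def by (rule continuous_on_affine_component)
  note h_cont = continuous_on_continuously_differentiable[OF h]
  note g_cont = continuous_on_grad_component[OF h]
  have [measurable]: "(\<lambda>z. x z $ i) \<in> borel_measurable borel" "h \<in> borel_measurable borel" for i
    by (intro borel_measurable_continuous_onI x_cont h_cont)+
  \<comment> \<open>The product rule in direction \<open>j\<close>: the affine function
    \<open>x z $ i\<close> has the constant partial derivative
    \<open>matrix_inv S $ i $ j\<close>.\<close>
  let ?e = "\<lambda>z. matrix_inv S $ i $ j * h z + x z $ i * grad h z $ j"
  have f: "integrable (gauss \<mu> S) (\<lambda>z. x z $ i * h z)"
  proof (rule Bochner_Integration.integrable_bound)
    show "integrable (gauss \<mu> S) (\<lambda>z. \<bar>h z\<bar> + \<bar>x z $ i * x z $ i * h z\<bar>)"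
      using int_h int_xxh by auto
    have "\<bar>a\<bar> \<le> 1 + a * a" for a :: real
      using zero_le_power2[of "\<bar>a\<bar> - 1"] by (simp add: power2_eq_square algebra_simps)
    then have "\<bar>x z $ i\<bar> * \<bar>h z\<bar> \<le> (1 + x z $ i * x z $ i) * \<bar>h z\<bar>" for z
      by (rule mult_right_mono) simp
    then show "AE z in gauss \<mu> S. norm (x z $ i * h z) \<le> norm (\<bar>h z\<bar> + \<bar>x z $ i * x z $ i * h z\<bar>)"
      by (simp add: abs_mult distrib_right)
  qed measurable
  have e_cont: "continuous_on UNIV ?e"
    by (intro continuous_on_add continuous_on_mult continuous_on_const h_cont x_cont g_cont)
  have "integral\<^sup>L (gauss \<mu> S) ?e = integral\<^sup>L (gauss \<mu> S) (\<lambda>z. x z $ j * (x z $ i * h z))"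
    unfolding x_def
  proof (rule gauss_integration_by_parts[OF S], fold x_def)
    show "integrable (gauss \<mu> S) (\<lambda>z. x z $ i * h z)" by (rule f)
    show "integrable (gauss \<mu> S) ?e"
      using int_h int_xg by simp
    show "integrable (gauss \<mu> S) (\<lambda>z. x z $ j * (x z $ i * h z))"
      using int_xxh[of j i] by (simp add: mult.assoc)
    show "AE w in (\<Pi>\<^sub>M k\<in>UNIV - {j}. lborel). \<forall>a b. a \<le> b \<longrightarrow>
        set_integrable lborel {a..b} (\<lambda>t. ?e (coord_line j w t)) \<and>
        (\<forall>y\<in>{a..b}. x (coord_line j w y) $ i * h (coord_line j w y) =
           x (coord_line j w a) $ i * h (coord_line j w a) + (LBINT t:{a..y}. ?e (coord_line j w t)))"
    \<comment> \<open>The function is continuously differentiable, so the fundamental theorem holds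
      on every line, without an exceptional set.\<close>
    proof (intro AE_I2 allI impI conjI ballI)
      fix w and a b :: real assume "a \<le> b"
      let ?l = "coord_line j w"
      have el_cont: "continuous_on X (\<lambda>t. ?e (?l t))" for X
        by (rule continuous_on_compose2[OF e_cont continuous_on_subset[OF continuous_on_coord_line]]) auto
      show "set_integrable lborel {a..b} (\<lambda>t. ?e (?l t))"
        by (rule borel_integrable_atLeastAtMost'[OF el_cont])
      fix y assume y: "y \<in> {a..b}"
      have "((\<lambda>t. x (?l t) $ i * h (?l t)) has_real_derivative ?e (?l t)) (at t)" for t
      proof -
        have "((\<lambda>z. matrix_inv S *v (z - \<mu>)) has_derivative (\<lambda>v. matrix_inv S *v v)) (at z)" for z
          by (rule derivative_eq_intros bounded_linear.has_derivative[OF matrix_vector_mul_bounded_linear] refl | simp)+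
        then have "((\<lambda>z. x z $ i) has_derivative (\<lambda>v. (matrix_inv S *v v) $ i)) (at z)" for z
          unfolding x_def by (rule bounded_linear.has_derivative[OF bounded_linear_vec_nth])
        from has_real_derivative_coord_line[OF this]
        have 1: "((\<lambda>t. x (?l t) $ i) has_real_derivative matrix_inv S $ i $ j) (at t)"
          by (simp add: matrix_vector_mul_component inner_axis)
        have 2: "((\<lambda>t. h (?l t)) has_real_derivative grad h (?l t) $ j) (at t)"
          using has_real_derivative_coord_line[OF has_derivative_grad[OF h]] by (simp add: inner_axis')
        show ?thesis
          using DERIV_mult[OF 1 2] by (simp add: mult_ac add_ac)
      qed
      then have "(LBINT t. indicator {a..y} t *\<^sub>R ?e (?l t)) = x (?l y) $ i * h (?l y) - x (?l a) $ i * h (?l a)"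
        using y by (intro integral_FTC_atLeastAtMost el_cont)
          (auto simp: has_real_derivative_iff_has_vector_derivative intro: has_vector_derivative_at_within)
      then show "x (?l y) $ i * h (?l y) = x (?l a) $ i * h (?l a) + (LBINT t:{a..y}. ?e (?l t))"
        unfolding set_lebesgue_integral_def by simp
    qed
  qed
  moreover have "integral\<^sup>L (gauss \<mu> S) ?e =
      matrix_inv S $ i $ j * integral\<^sup>L (gauss \<mu> S) h + integral\<^sup>L (gauss \<mu> S) (\<lambda>z. x z $ i * grad h z $ j)"
    using int_h int_xg by simp
  moreover have "integral\<^sup>L (gauss \<mu> S) (\<lambda>z. (x z $ i * x z $ j - matrix_inv S $ i $ j) * h z) =
      integral\<^sup>L (gauss \<mu> S) (\<lambda>z. x z $ j * (x z $ i * h z)) - matrix_inv S $ i $ j * integral\<^sup>L (gauss \<mu> S) h"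
  proof -
    have "(\<lambda>z. (x z $ i * x z $ j - matrix_inv S $ i $ j) * h z) =
        (\<lambda>z. x z $ j * (x z $ i * h z) - matrix_inv S $ i $ j * h z)"
      by (simp add: fun_eq_iff algebra_simps)
    then show ?thesis
      using int_h int_xxh[of j i] by (simp add: mult.assoc)
  qed
  ultimately show "integral\<^sup>L (gauss \<mu> S) (\<lambda>z. (x z $ i * x z $ j - matrix_inv S $ i $ j) * h z) =
     integral\<^sup>L (gauss \<mu> S) (\<lambda>z. x z $ i * grad h z $ j)"
    by simp
qed

text \<open>Integration by parts in direction \<open>i\<close> for the \<open>j\<close>-th gradient
  component, which is absolutely continuous only on almost every line. The hypothesis
  \<open>int_xg\<close> ranges over all indices because every component of \<open>x z\<close> enters
  the bound on the gradient.\<close>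

lemma integral_gauss_hessian_eq_grad:
  fixes \<mu> :: "real^'n" and S :: "real^'n^'n" and h :: "real^'n \<Rightarrow> real"
  defines "x z \<equiv> matrix_inv S *v (z - \<mu>)"
  assumes S: "sym_pos_def S" and h: "continuously_differentiable h"
    and ACL: "locally_ACL (grad h)"
    and int_xg: "\<And>i j. integrable (gauss \<mu> S) (\<lambda>z. x z $ i * grad h z $ j)"
    and hess: "integrable (gauss \<mu> S) (\<lambda>z. hessian h z $ i $ j)"
  shows "integral\<^sup>L (gauss \<mu> S) (\<lambda>z. hessian h z $ i $ j) =
         integral\<^sup>L (gauss \<mu> S) (\<lambda>z. x z $ i * grad h z $ j)"
proof -
  define q where "q = gauss_density \<mu> S"
  have q_cont: "continuous_on X q" for X
    unfolding q_def by (rule continuous_on_gauss_density[OF S])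
  note g_cont = continuous_on_grad_component[OF h]
  have [measurable]: "(\<lambda>z. x z $ i) \<in> borel_measurable borel"
    "(\<lambda>z. grad h z $ i) \<in> borel_measurable borel" for i
    unfolding x_def by (intro borel_measurable_continuous_onI continuous_on_affine_component g_cont)+
  have hess_meas [measurable]: "(\<lambda>z. hessian h z $ i $ j) \<in> borel_measurable borel"
    using borel_measurable_integrable[OF hess] by (simp cong: measurable_cong_sets)
  have g: "integrable (gauss \<mu> S) (\<lambda>z. grad h z $ j)"
  proof -
    \<comment> \<open>The set where \<open>norm (x z) \<le> 1\<close>, written as an image of the
      unit ball under the inverse affine map so that its compactness is immediate.\<close>
    let ?K = "(\<lambda>y. \<mu> + S *v y) ` cball 0 1"
    have K: "norm (x z) \<ge> 1" if "z \<notin> ?K" for z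
    proof (rule ccontr)
      assume "\<not> 1 \<le> norm (x z)"
      moreover have "z = \<mu> + S *v x z"
        by (simp add: x_def matrix_vector_mul_assoc matrix_inv_right[OF sym_pos_def_invertible[OF S]])
      ultimately have "z \<in> ?K"
        by (intro image_eqI[where x = "x z"]) auto
      with that show False by contradiction
    qed
    have "compact ?K"
      by (intro compact_continuous_image compact_cball continuous_intros
          bounded_linear.continuous_on[OF matrix_vector_mul_bounded_linear])
    then have int_K: "integrable lborel (\<lambda>z. indicator ?K z *\<^sub>R (q z * grad h z $ j))"
      by (intro borel_integrable_compact continuous_intros q_cont g_cont)
    have int_k: "integrable lborel (\<lambda>z. q z * (x z $ k * grad h z $ j))" for k
      using int_xg[of k j] unfolding q_def by (subst (asm) integrable_gauss_iff[OF S]) measurable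
    have "integrable lborel (\<lambda>z. q z * grad h z $ j)"
    proof (rule Bochner_Integration.integrable_bound)
      show "integrable lborel (\<lambda>z. \<bar>indicator ?K z *\<^sub>R (q z * grad h z $ j)\<bar>
          + (\<Sum>k\<in>UNIV. \<bar>q z * (x z $ k * grad h z $ j)\<bar>))"
        by (intro Bochner_Integration.integrable_add integrable_abs int_K Bochner_Integration.integrable_sum int_k)
      show "(\<lambda>z. q z * grad h z $ j) \<in> borel_measurable lborel"
        using borel_measurable_continuous_onI[OF q_cont] by measurable
      have "\<bar>q z * grad h z $ j\<bar> \<le> \<bar>indicator ?K z *\<^sub>R (q z * grad h z $ j)\<bar>
          + (\<Sum>k\<in>UNIV. \<bar>q z * (x z $ k * grad h z $ j)\<bar>)" for z
      proof (cases "z \<in> ?K")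
        \<comment> \<open>Off \<open>?K\<close> the l1 norm of \<open>x z\<close> dominates its
          Euclidean norm, which is at least 1.\<close>
        case False
        then have "1 \<le> (\<Sum>k\<in>UNIV. \<bar>x z $ k\<bar>)"
          using K norm_le_l1_cart[of "x z"] by fastforce
        then have "1 * \<bar>q z * grad h z $ j\<bar> \<le> (\<Sum>k\<in>UNIV. \<bar>x z $ k\<bar>) * \<bar>q z * grad h z $ j\<bar>"
          by (rule mult_right_mono) simp
        also have "\<dots> = (\<Sum>k\<in>UNIV. \<bar>q z * (x z $ k * grad h z $ j)\<bar>)"
          unfolding sum_distrib_right by (simp add: abs_mult mult_ac)
        finally show ?thesis by simp
      qed (simp add: sum_nonneg)
      then show "AE z in lborel. norm (q z * grad h z $ j) \<le>
          norm (\<bar>indicator ?K z *\<^sub>R (q z * grad h z $ j)\<bar> + (\<Sum>k\<in>UNIV. \<bar>q z * (x z $ k * grad h z $ j)\<bar>))"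
        by (intro AE_I2) (smt (verit) real_norm_def)
    qed
    then show ?thesis
      unfolding q_def by (subst integrable_gauss_iff[OF S]) measurable
  qed
  show "integral\<^sup>L (gauss \<mu> S) (\<lambda>z. hessian h z $ i $ j) =
       integral\<^sup>L (gauss \<mu> S) (\<lambda>z. x z $ i * grad h z $ j)"
    unfolding x_def
  proof (rule gauss_integration_by_parts[OF S g hess], fold x_def)
    show "integrable (gauss \<mu> S) (\<lambda>z. x z $ i * grad h z $ j)" by (rule int_xg)
    have "AE w in (\<Pi>\<^sub>M k\<in>UNIV - {i}. lborel). locally_AC (\<lambda>t. grad h (coord_line i w t))"
      using ACL by (simp add: locally_ACL_def coord_line_def)
    then show "AE w in (\<Pi>\<^sub>M k\<in>UNIV - {i}. lborel). \<forall>a b. a \<le> b \<longrightarrow>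
        set_integrable lborel {a..b} (\<lambda>t. hessian h (coord_line i w t) $ i $ j) \<and>
        (\<forall>y\<in>{a..b}. grad h (coord_line i w y) $ j =
           grad h (coord_line i w a) $ j + (LBINT t:{a..y}. hessian h (coord_line i w t) $ i $ j))"
    proof eventually_elim
      case (elim w)
      have eq: "deriv (\<lambda>s. grad h (coord_line i w s) $ j) t = hessian h (coord_line i w t) $ i $ j" for t
        by (simp add: hessian_def partial_deriv_coord_line)
      \<comment> \<open>Borel measurability of the derivative on the line is inherited from that of
        the Hessian entry on the whole space, which is part of its integrability.\<close>
      have "coord_line i w \<in> borel_measurable borel"
        by (rule borel_measurable_continuous_onI[OF continuous_on_coord_line])
      then have "(\<lambda>t. deriv (\<lambda>s. grad h (coord_line i w s) $ j) t) \<in> borel_measurable borel"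
        unfolding eq by measurable
      then show ?case
        using elim AC_on_component[where g = "\<lambda>t. grad h (coord_line i w t)" and j = j]
        unfolding locally_AC_def eq by blast
    qed
  qed
qed

section \<open>From entrywise identities to the matrix identities\<close>

theorem theorem4:
  fixes \<mu> :: "real^'n" and S :: "real^'n^'n" and h :: "real^'n \<Rightarrow> real"
  assumes "sym_pos_def S"
    and "continuously_differentiable h"
    and "locally_ACL (grad h)"
    and "integrable (gauss \<mu> S) h"
    and "integrable (gauss \<mu> S) (\<lambda>z. outer (matrix_inv S *v (z - \<mu>)) (grad h z))"
    and "integrable (gauss \<mu> S) (hessian h)"
    and "integrable (gauss \<mu> S)
           (\<lambda>z. (h z / gauss_density \<mu> S z) *\<^sub>R sym_grad (\<lambda>S'. gauss_density \<mu> S' z) S)"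
    and "has_sym_grad (\<lambda>S'. integral\<^sup>L (gauss \<mu> S') h)
           (integral\<^sup>L (gauss \<mu> S)
             (\<lambda>z. (h z / gauss_density \<mu> S z) *\<^sub>R sym_grad (\<lambda>S'. gauss_density \<mu> S' z) S)) S"
  shows "sym_grad (\<lambda>S'. integral\<^sup>L (gauss \<mu> S') h) S =
           (1/2) *\<^sub>R integral\<^sup>L (gauss \<mu> S) (\<lambda>z. outer (matrix_inv S *v (z - \<mu>)) (grad h z))
       \<and> (1/2) *\<^sub>R integral\<^sup>L (gauss \<mu> S) (\<lambda>z. outer (matrix_inv S *v (z - \<mu>)) (grad h z)) =
           (1/2) *\<^sub>R integral\<^sup>L (gauss \<mu> S) (hessian h)"
proof -
  define x where "x z = matrix_inv S *v (z - \<mu>)" for z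
  note S = assms(1) and h = assms(2)
  let ?G = "\<lambda>z. (h z / gauss_density \<mu> S z) *\<^sub>R sym_grad (\<lambda>S'. gauss_density \<mu> S' z) S"
  \<comment> \<open>The positive density cancels against the one in its own gradient.\<close>
  have G: "?G z $ i $ j = (x z $ i * x z $ j - matrix_inv S $ i $ j) * h z / 2" for z i j
    using gauss_density_pos[OF S, of \<mu> z]
    by (simp add: sym_grad_gauss_density[OF S] outer_def x_def)
  have xg: "integrable (gauss \<mu> S) (\<lambda>z. x z $ i * grad h z $ j)" for i j
    using integrable_matrix_nth[OF assms(5), of i j] by (simp add: outer_def x_def)
  \<comment> \<open>Second moments are recovered from the integrable matrix entry by adding back the
    multiple of \<open>h\<close> that was subtracted, integrable because \<open>h\<close>
    is.\<close>
  have xxh: "integrable (gauss \<mu> S) (\<lambda>z. x z $ i * x z $ j * h z)" for i j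
  proof -
    have "integrable (gauss \<mu> S) (\<lambda>z. 2 * ((x z $ i * x z $ j - matrix_inv S $ i $ j) * h z / 2)
        + matrix_inv S $ i $ j * h z)"
      using integrable_matrix_nth[OF assms(7), of i j, unfolded G] assms(4)
      by (intro Bochner_Integration.integrable_add integrable_mult_right) auto
    also have "(\<lambda>z. 2 * ((x z $ i * x z $ j - matrix_inv S $ i $ j) * h z / 2)
        + matrix_inv S $ i $ j * h z) = (\<lambda>z. x z $ i * x z $ j * h z)"
      by (simp add: fun_eq_iff field_simps)
    finally show ?thesis .
  qed
  have "integral\<^sup>L (gauss \<mu> S) ?G $ i $ j =
      ((1/2) *\<^sub>R integral\<^sup>L (gauss \<mu> S) (\<lambda>z. outer (x z) (grad h z))) $ i $ j" for i j
    using integral_gauss_second_moment_eq_grad[OF S h assms(4) xg[unfolded x_def] xxh[unfolded x_def], of i j]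
      integral_matrix_nth[OF assms(7), of i j, unfolded G] integral_matrix_nth[OF assms(5), of i j]
    by (simp add: x_def outer_def)
  then have "integral\<^sup>L (gauss \<mu> S) ?G = (1/2) *\<^sub>R integral\<^sup>L (gauss \<mu> S) (\<lambda>z. outer (x z) (grad h z))"
    by (simp add: vec_eq_iff)
  moreover have "integral\<^sup>L (gauss \<mu> S) (\<lambda>z. outer (x z) (grad h z)) $ i $ j =
      integral\<^sup>L (gauss \<mu> S) (hessian h) $ i $ j" for i j
    using integral_gauss_hessian_eq_grad[OF S h assms(3) xg[unfolded x_def] integrable_matrix_nth[OF assms(6)], of i j]
      integral_matrix_nth[OF assms(6), of i j] integral_matrix_nth[OF assms(5), of i j]
    by (simp add: x_def outer_def)
  then have "integral\<^sup>L (gauss \<mu> S) (\<lambda>z. outer (x z) (grad h z)) = integral\<^sup>L (gauss \<mu> S) (hessian h)"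
    by (simp add: vec_eq_iff)
  \<comment> \<open>By uniqueness of the symmetric gradient, the interchange hypothesis identifies
    the left-hand side with the expectation of \<open>?G\<close>.\<close>
  ultimately show ?thesis
    using sym_grad_eqI[OF assms(8)] by (simp add: x_def)
qed

end
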